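(* Let $\mathcal D$ be the data of a Det-POMDP whose sets $\mathbb T,\mathbb X,\mathbb U,\mathbb O$ are finite. Let $(u,o)\in\mathbb U\times\mathbb O$ and $t\in\mathbb T\setminus\{T\}$. Then the belief evolution mapping $\theta_t$ satisfies $$\theta_t(b,u,o)=\mathcal N\circ(\phi_t^{u,o})_\star(b)\qquad\text{for all } b\in\mathbb B .$$
   Context: **Det-POMDP data.** A Det-POMDP is given by $\mathcal D=(\mathbb T,\mathbb U,\mathbb O,\mathbb X,(\mathcal L_t)_{t\in\mathbb T},(\varphi_t)_{t\in\mathbb T\setminus\{T\}},(\mathbb U^{\mathrm{ad}}_t)_{t\in\mathbb T\setminus\{T\}},(\beta_t)_{t\in\mathbb T})$, where $\mathbb T=\{0,1,\dots,T\}$ is the set of stages with horizon an integer $T\ge 1$; $\mathbb U,\mathbb O,\mathbb X$ are the sets of controls, observations and states; $\mathcal L_t:\mathbb X\times\mathbb U\to\mathbb R\cup\{+\infty\}$ ($t<T$) and $\mathcal L_T:\mathbb X\to\mathbb R\cup\{+\infty\}$ are costs; $\varphi_t:\mathbb X\times\mathbb U\to\mathbb X$ are the dynamics; $\mathbb U^{\mathrm{ad}}_t:\mathbb X\rightrightarrows\mathbb U$ are set-valued admissibility constraints; $\beta_0:\mathbb X\to\mathbb O$ and $\beta_t:\mathbb X\times\mathbb U\to\mathbb O$ ($t\ge1$) are observation mappings. Write $\varphi_t^u=\varphi_t(\cdot,u)$ and $\beta_t^u=\beta_t(\cdot,u)$. **Beliefs.** $\Delta(\mathbb Y)$ is the set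 of probability distributions on a finite set $\mathbb Y$. Let $\partial\notin\mathbb X$, $\overline{\mathbb X}=\mathbb X\cup\{\partial\}$, let $\delta_\partial$ be the Dirac measure at $\partial$, and let $\mathbb B=\Delta(\mathbb X)\cup\{\delta_\partial\}\subset\Delta(\overline{\mathbb X})$, where $\Delta(\mathbb X)$ is identified with the probabilities on $\overline{\mathbb X}$ supported in $\mathbb X$. **Belief dynamics.** For $t\in\mathbb T\setminus\{T\}$ and $(b,u,o)\in\mathbb B\times\mathbb U\times\mathbb O$, let $Q_{t+1}(b,u,o)=b\bigl((\beta^u_{t+1}\circ\varphi^u_t)^{-1}(o)\bigr)$. Define $\theta_t:\mathbb B\times\mathbb U\times\mathbb O\to\mathbb B$ by: for $y\in\mathbb X$, $\theta_t(b,u,o)(y)=b\bigl((\varphi_t^u)^{-1}(y)\bigr)/Q_{t+1}(b,u,o)$ if $Q_{t+1}(b,u,o)\ne0$ and $y\in(\beta_{t+1}^u)^{-1}(o)$, and $\theta_t(b,u,o)(y)=0$ otherwise; and $\theta_t(b,u,o)(\partial)=1-\theta_t(b,u,o)(\mathbb X)$. **Mappings $\phi_t^{u,o}$.** Define $\phi_t^{u,o}:\overline{\mathbb X}\to\overline{\mathbb X}$ by $\phi_t^{u,o}(\bar x)=\varphi_t^u(\bar x)$ if $\bar x\ne\partial$ and $\varphi_t^u(\bar x)\in(\beta_{t+1}^u)^{-1}(o)$, and $\phi_t^{u,o}(\bar x)=\partial$ otherwise. **Pushforward and renormalization.** For a mapping $h:\mathbb A\to\mathbb D$ between finite sets and $\mu\in\Delta(\mathbb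 A)$, $(h_\star\mu)(d)=\mu(h^{-1}(d))$. The renormalization mapping $\mathcal N:\Delta(\overline{\mathbb X})\to\Delta(\overline{\mathbb X})$ sends $\nu$ to the probability equal to $\frac{1}{\nu(\mathbb X)}\nu_{|\mathbb X}$ on $\mathbb X$ and giving mass $0$ to $\partial$ if $\nu(\mathbb X)\neq0$, and sends $\nu$ to $\delta_\partial$ if $\nu(\mathbb X)=0$. *)

theory Defs
  imports "HOL-Probability.Probability"
begin

text \<open>
  The sets of states, controls and observations are the universes of the type variables
  \<open>'x\<close>, \<open>'u\<close>, \<open>'z\<close>. Families indexed by stages are total functions on \<open>nat\<close>; only their
  values at the stages allowed by the horizon are meaningful.
\<close>

record ('x, 'u, 'z) det_pomdp_data =
  horizon :: nat
  stage_cost :: "nat \<Rightarrow> 'x \<Rightarrow> 'u \<Rightarrow> ereal"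
  final_cost :: "'x \<Rightarrow> ereal"
  dyn :: "nat \<Rightarrow> 'x \<Rightarrow> 'u \<Rightarrow> 'x"
  adm :: "nat \<Rightarrow> 'x \<Rightarrow> 'u set"
  obs_init :: "'x \<Rightarrow> 'z"
  obs :: "nat \<Rightarrow> 'x \<Rightarrow> 'u \<Rightarrow> 'z"

definition stages :: "('x, 'u, 'z) det_pomdp_data \<Rightarrow> nat set" where
  "stages D = {0..horizon D}"

text \<open>Costs take values in \<open>\<real> \<union> {+\<infinity>}\<close>, hence the exclusion of \<open>-\<infinity>\<close>.\<close>

definition det_pomdp :: "('x, 'u, 'z) det_pomdp_data \<Rightarrow> bool" where
  "det_pomdp D \<longleftrightarrow>
     horizon D \<ge> 1 \<and>
     (\<forall>t \<in> stages D - {horizon D}. \<forall>x u. stage_cost D t x u \<noteq> -\<infinity>) \<and>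
     (\<forall>x. final_cost D x \<noteq> -\<infinity>)"

definition dyn_at :: "('x, 'u, 'z) det_pomdp_data \<Rightarrow> nat \<Rightarrow> 'u \<Rightarrow> 'x \<Rightarrow> 'x" where
  "dyn_at D t u = (\<lambda>x. dyn D t x u)"

definition obs_at :: "('x, 'u, 'z) det_pomdp_data \<Rightarrow> nat \<Rightarrow> 'u \<Rightarrow> 'x \<Rightarrow> 'z" where
  "obs_at D t u = (\<lambda>x. obs D t x u)"

text \<open>
  The extended state space is \<open>'x option\<close>, with \<open>None\<close> as the cemetery point; a subset \<open>A\<close>
  of the state space becomes \<open>Some ` A\<close>. Probability distributions are of type \<open>pmf\<close>, and
  pushforward along \<open>h\<close> is \<open>map_pmf h\<close>.
\<close>

definition beliefs :: "'x option pmf set" where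
  "beliefs = {b. set_pmf b \<subseteq> range Some} \<union> {return_pmf None}"

text \<open>\<open>obs_prob D t b u z\<close> is \<open>Q\<^sub>t\<^sub>+\<^sub>1(b, u, z)\<close>: the index is that of the current stage.\<close>

definition obs_prob ::
  "('x, 'u, 'z) det_pomdp_data \<Rightarrow> nat \<Rightarrow> 'x option pmf \<Rightarrow> 'u \<Rightarrow> 'z \<Rightarrow> real" where
  "obs_prob D t b u z =
     measure_pmf.prob b (Some ` ((obs_at D (t + 1) u \<circ> dyn_at D t u) -` {z}))"

definition theta_state ::
  "('x, 'u, 'z) det_pomdp_data \<Rightarrow> nat \<Rightarrow> 'x option pmf \<Rightarrow> 'u \<Rightarrow> 'z \<Rightarrow> 'x \<Rightarrow> real" where
  "theta_state D t b u z y =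
     (if obs_prob D t b u z \<noteq> 0 \<and> y \<in> obs_at D (t + 1) u -` {z}
      then measure_pmf.prob b (Some ` (dyn_at D t u -` {y})) / obs_prob D t b u z
      else 0)"

definition theta_mass ::
  "('x::finite, 'u, 'z) det_pomdp_data \<Rightarrow> nat \<Rightarrow> 'x option pmf \<Rightarrow> 'u \<Rightarrow> 'z \<Rightarrow> 'x option \<Rightarrow> real" where
  "theta_mass D t b u z w =
     (case w of
        Some y \<Rightarrow> theta_state D t b u z y
      | None \<Rightarrow> 1 - (\<Sum>y\<in>UNIV. theta_state D t b u z y))"

text \<open>\<open>embed_pmf\<close> is only specified on genuine mass functions; see \<open>pmf_theta\<close> below.\<close>

definition theta ::
  "('x::finite, 'u, 'z) det_pomdp_data \<Rightarrow> nat \<Rightarrow> 'x option pmf \<Rightarrow> 'u \<Rightarrow> 'z \<Rightarrow> 'x option pmf" where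
  "theta D t b u z = embed_pmf (theta_mass D t b u z)"

definition phi ::
  "('x, 'u, 'z) det_pomdp_data \<Rightarrow> nat \<Rightarrow> 'u \<Rightarrow> 'z \<Rightarrow> 'x option \<Rightarrow> 'x option" where
  "phi D t u z w =
     (case w of
        Some x \<Rightarrow> if dyn_at D t u x \<in> obs_at D (t + 1) u -` {z} then Some (dyn_at D t u x) else None
      | None \<Rightarrow> None)"

definition renorm :: "'x option pmf \<Rightarrow> 'x option pmf" where
  "renorm \<nu> =
     (if measure_pmf.prob \<nu> (range Some) \<noteq> 0 then cond_pmf \<nu> (range Some) else return_pmf None)"

lemma pmf_renorm:
  assumes "measure_pmf.prob \<nu> (range Some) \<noteq> 0"
  shows "pmf (renorm \<nu>) (Some y) = pmf \<nu> (Some y) / measure_pmf.prob \<nu> (range Some)"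
    and "pmf (renorm \<nu>) None = 0"
proof -
  have "set_pmf \<nu> \<inter> range Some \<noteq> {}"
    using assms by (auto simp: measure_pmf_zero_iff)
  then show "pmf (renorm \<nu>) (Some y) = pmf \<nu> (Some y) / measure_pmf.prob \<nu> (range Some)"
    and "pmf (renorm \<nu>) None = 0"
    using assms by (auto simp: renorm_def pmf_cond)
qed

lemma theta_state_nonneg: "theta_state D t b u z y \<ge> 0"
  by (simp add: theta_state_def obs_prob_def)

lemma sum_theta_state:
  fixes D :: "('x::finite, 'u, 'z) det_pomdp_data"
  shows "(\<Sum>y\<in>UNIV. theta_state D t b u z y) = (if obs_prob D t b u z \<noteq> 0 then 1 else 0)"
proof (cases "obs_prob D t b u z = 0")
  case True
  then show ?thesis by (simp add: theta_state_def)
next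
  case False
  let ?B = "obs_at D (t + 1) u -` {z}"
  let ?P = "\<lambda>y. Some ` (dyn_at D t u -` {y})"
  have "(\<Sum>y\<in>?B. measure_pmf.prob b (?P y)) = measure_pmf.prob b (\<Union>y\<in>?B. ?P y)"
    by (subst measure_pmf.finite_measure_finite_Union) (auto simp: disjoint_family_on_def)
  also have "(\<Union>y\<in>?B. ?P y) = Some ` ((obs_at D (t + 1) u \<circ> dyn_at D t u) -` {z})"
    by auto
  finally have "(\<Sum>y\<in>?B. measure_pmf.prob b (?P y)) = obs_prob D t b u z"
    by (simp add: obs_prob_def)
  moreover have "(\<Sum>y\<in>UNIV. theta_state D t b u z y)
      = (\<Sum>y\<in>?B. measure_pmf.prob b (?P y) / obs_prob D t b u z)"
    using False by (intro sum.mono_neutral_cong_right) (auto simp: theta_state_def)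
  ultimately show ?thesis
    using False by (simp flip: sum_divide_distrib)
qed

lemma pmf_theta: "pmf (theta D t b u z) w = theta_mass D t b u z w"
  unfolding theta_def
proof (rule pmf_embed_pmf)
  show nn: "0 \<le> theta_mass D t b u z w" for w
    by (auto simp: theta_mass_def sum_theta_state theta_state_nonneg split: option.split)
  have "(\<Sum>w\<in>UNIV. theta_mass D t b u z w) = 1"
    by (simp add: UNIV_option_conv sum.reindex theta_mass_def)
  then show "(\<integral>\<^sup>+w. ennreal (theta_mass D t b u z w) \<partial>count_space UNIV) = 1"
    by (simp add: nn_integral_count_space_finite nn)
qed

lemma theta_in_beliefs: "theta D t b u z \<in> beliefs"
proof (cases "obs_prob D t b u z = 0")
  case True
  then have "pmf (theta D t b u z) w = pmf (return_pmf None) w" for w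
    by (cases w) (auto simp: pmf_theta theta_mass_def sum_theta_state theta_state_def)
  then show ?thesis by (simp add: beliefs_def pmf_eq_iff)
next
  case False
  then have "pmf (theta D t b u z) None = 0"
    by (simp add: pmf_theta theta_mass_def sum_theta_state)
  then have "set_pmf (theta D t b u z) \<subseteq> range Some"
    by (metis notin_range_Some pmf_eq_0_set_pmf subsetI)
  then show ?thesis by (simp add: beliefs_def)
qed

end

theory Submission
  imports Defs
begin

text \<open>Write Q for \<open>obs_prob D t b u z\<close>. The fibre of \<open>phi\<close> over a
  state y is the fibre of the dynamics if y emits z, and empty otherwise, so the pushforward of b
  gives y the numerator of \<open>theta_state\<close>, or 0 (\<open>phi_vimage_Some\<close>). These
  fibres together form the event with probability Q, so the pushforward has mass Q on the states
  (\<open>prob_map_phi_range_Some\<close>). Renormalizing is thus division by Q.\<close>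

lemma phi_vimage_Some:
  "phi D t u z -` {Some y} =
     (if y \<in> obs_at D (t + 1) u -` {z} then Some ` (dyn_at D t u -` {y}) else {})"
  by (auto simp: phi_def split: option.splits if_splits)

lemma phi_vimage_range_Some:
  "phi D t u z -` range Some = Some ` ((obs_at D (t + 1) u \<circ> dyn_at D t u) -` {z})"
  by (auto simp: phi_def split: option.splits if_splits)

text \<open>Makes \<open>theta\<close> and \<open>renorm\<close> branch on the same condition and
  divide by the same constant.\<close>

lemma prob_map_phi_range_Some:
  "measure_pmf.prob (map_pmf (phi D t u z) b) (range Some) = obs_prob D t b u z"
  by (simp add: measure_map_pmf phi_vimage_range_Some obs_prob_def)

lemma theta_eq_renorm_map_phi:
  fixes D :: "('x::finite, 'u, 'z) det_pomdp_data"
  shows "theta D t b u z = renorm (map_pmf (phi D t u z) b)"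
proof (rule pmf_eqI)
  fix w
  let ?\<nu> = "map_pmf (phi D t u z) b"
  show "pmf (theta D t b u z) w = pmf (renorm ?\<nu>) w"
  proof (cases "obs_prob D t b u z = 0")
    case True
    then have "renorm ?\<nu> = return_pmf None"
      unfolding renorm_def prob_map_phi_range_Some by simp
    \<comment> \<open>All state masses of \<open>theta\<close> vanish, so its complement rule puts
      mass 1 on \<open>None\<close>.\<close>
    with True show ?thesis
      by (cases w) (simp_all add: pmf_theta theta_mass_def sum_theta_state theta_state_def)
  next
    case False
    then have nz: "measure_pmf.prob ?\<nu> (range Some) \<noteq> 0"
      unfolding prob_map_phi_range_Some .
    show ?thesis
    proof (cases w)
      case None
      \<comment> \<open>The state masses of \<open>theta\<close> sum to 1, leaving 0 for
        \<open>None\<close>.\<close>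
      with False show ?thesis
        by (simp add: pmf_theta theta_mass_def sum_theta_state pmf_renorm(2)[OF nz])
    next
      case (Some y)
      \<comment> \<open>If y does not emit z, its fibre is empty and both sides are 0.\<close>
      with False show ?thesis
        unfolding Some pmf_renorm(1)[OF nz] prob_map_phi_range_Some
        by (simp add: pmf_theta theta_mass_def theta_state_def pmf_map phi_vimage_Some)
    qed
  qed
qed

theorem mainTheorem4:
  fixes D :: "('x::finite, 'u::finite, 'z::finite) det_pomdp_data"
    and t :: nat and u :: 'u and z :: 'z
  assumes "det_pomdp D"
    and "t \<in> stages D - {horizon D}"
  shows "\<forall>b \<in> beliefs. theta D t b u z = (renorm \<circ> map_pmf (phi D t u z)) b"
  by (simp add: theta_eq_renorm_map_phi)

end
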